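(* Let $d\ge1$ be an integer, let $\alpha\in(0,d)$, let $2\le p<\frac{2d}{\alpha}$, and let $\delta>0$. Let $\{f_N\}_{N\in\mathbb{N}}$ be a sequence of signals with $f_N\in D_{\delta,N}$, and let $S_N\subset\mathbb{Z}_N^d$ be sets (of unobserved frequencies, meaning that $\widehat f_N(m)$ is known exactly for $m\notin S_N$ and unknown for $m\in S_N$). Suppose that there is a constant $C_{\mathrm{size}}>0$ such that $|S_N|\le C_{\mathrm{size}}N^\alpha$ for all $N$. If $$\|f_N\|_{L^p(\mathbb{Z}_N^d)}<\frac{\delta}{2\sqrt{C_{\mathrm{size}}}}\,N^{\frac dp-\frac\alpha2}$$ for all sufficiently large $N$, then for all sufficiently large $N$ the signal $f_N$ is the unique solution of the minimization problem $$\operatorname*{argmin}_{u\in D_{\delta,N}}\|u\|_{L^p(\mathbb{Z}_N^d)}\quad\text{subject to}\quad\widehat u(m)=\widehat f_N(m)\ \text{ for every } m\notin S_N.$$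
   Context: $\mathbb{Z}_N^d$ is the $d$-fold product of the cyclic group $\mathbb{Z}_N=\mathbb{Z}/N\mathbb{Z}$; $\mathbb{N}$ is the set of positive integers. For $\delta>0$, $D_{\delta,N}:=\{u:\mathbb{Z}_N^d\to\mathbb{R}: u(x)\in\delta\mathbb{Z}\text{ for every }x\in\mathbb{Z}_N^d\}$ is the set of quantized signals. For $f:\mathbb{Z}_N^d\to\mathbb{C}$ the Fourier transform $\widehat f:\mathbb{Z}_N^d\to\mathbb{C}$ is $\widehat f(m)=N^{-d/2}\sum_{x\in\mathbb{Z}_N^d} f(x)e^{-2\pi i\, x\cdot m/N}$, where $x\cdot m=\sum_{j=1}^d x_jm_j$. Norms are with respect to counting measure: $\|f\|_{L^p(\mathbb{Z}_N^d)}=\left(\sum_{x\in\mathbb{Z}_N^d}|f(x)|^p\right)^{1/p}$ for $1\le p<\infty$. *)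

theory Defs
  imports Complex_Main "HOL-Algebra.Product_Groups"
begin

(* Residue classes are represented by {0..<int N}, and elements of Z_N^d by functions of the
   coordinate index 1..d that are undefined elsewhere. All of the following is meant for N > 0,
   because integer_mod_group 0 is the group of all integers. *)

definition ZN_power :: "nat \<Rightarrow> nat \<Rightarrow> (nat \<Rightarrow> int) set" where
  "ZN_power d N = carrier (product_group {1..d} (\<lambda>_. integer_mod_group N))"

(* Signals are extensional, so that equality of signals is equality of functions on Z_N^d. *)

definition quantized_signals :: "real \<Rightarrow> nat \<Rightarrow> nat \<Rightarrow> ((nat \<Rightarrow> int) \<Rightarrow> real) set" where
  "quantized_signals \<delta> d N = ZN_power d N \<rightarrow>\<^sub>E {\<delta> * of_int k |k::int. True}"

definition fourier :: "nat \<Rightarrow> nat \<Rightarrow> ((nat \<Rightarrow> int) \<Rightarrow> complex) \<Rightarrow> (nat \<Rightarrow> int) \<Rightarrow> complex" where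
  "fourier d N f m =
     complex_of_real (real N powr (- (real d / 2))) *
     (\<Sum>x\<in>ZN_power d N.
        f x * exp (- (2 * complex_of_real pi * \<i> * of_int (\<Sum>j=1..d. x j * m j) / of_nat N)))"

definition Lp_norm :: "nat \<Rightarrow> nat \<Rightarrow> real \<Rightarrow> ((nat \<Rightarrow> int) \<Rightarrow> 'a::real_normed_vector) \<Rightarrow> real" where
  "Lp_norm d N p f = (\<Sum>x\<in>ZN_power d N. norm (f x) powr p) powr (1 / p)"

definition feasible ::
  "real \<Rightarrow> nat \<Rightarrow> nat \<Rightarrow> (nat \<Rightarrow> int) set \<Rightarrow> ((nat \<Rightarrow> int) \<Rightarrow> real) \<Rightarrow> ((nat \<Rightarrow> int) \<Rightarrow> real) \<Rightarrow> bool"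
where
  "feasible \<delta> d N S f u \<longleftrightarrow>
     u \<in> quantized_signals \<delta> d N \<and>
     (\<forall>m \<in> ZN_power d N - S.
        fourier d N (\<lambda>x. complex_of_real (u x)) m = fourier d N (\<lambda>x. complex_of_real (f x)) m)"

end

theory Submission
  imports Defs "HOL-Analysis.Analysis"
begin

text \<open>
  If \<open>u\<close> is feasible and \<open>\<parallel>u\<parallel>\<^sub>p \<le> \<parallel>f\<parallel>\<^sub>p\<close>, then \<open>h = u - f\<close> has spectrum in \<open>S\<close>, so unless \<open>h = 0\<close> the
  uncertainty principle gives \<open>N\<^sup>d \<le> |S| |supp h|\<close>. The nonzero values of \<open>h\<close> have modulus at least
  \<open>\<delta>\<close>, hence \<open>\<parallel>h\<parallel>\<^sub>p \<ge> \<delta> (N\<^sup>d / |S|)\<^bsup>1/p\<^esup>\<close>; as \<open>1/p \<le> 1/2\<close> and \<open>|S| \<ge> 1\<close>, this is at least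
  \<open>\<delta> N\<^bsup>d/p\<^esup> (C N\<^bsup>\<alpha>\<^esup>)\<^bsup>-1/2\<^esup>\<close>, contradicting \<open>\<parallel>h\<parallel>\<^sub>p \<le> 2 \<parallel>f\<parallel>\<^sub>p\<close>.
\<close>

section \<open>The group of N-th residues and orthogonality of its characters\<close>

lemma ZN_power_eq_PiE:
  assumes "N > 0"
  shows "ZN_power d N = ({1..d} \<rightarrow>\<^sub>E {0..<int N})"
  using assms by (simp add: ZN_power_def carrier_integer_mod_group)

lemma finite_ZN_power: "N > 0 \<Longrightarrow> finite (ZN_power d N)"
  by (simp add: ZN_power_eq_PiE finite_PiE)

text \<open>This is a geometric sum over the powers of an N-th root of unity \<open>w\<close>: if
  \<open>w \<noteq> 1\<close>, the numerator \<open>w ^ N - 1\<close> vanishes, and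
  \<open>w = 1\<close> happens exactly when N divides \<open>a\<close>.\<close>

lemma sum_exp_int_mod:
  assumes "N > 0"
  shows "(\<Sum>k\<in>{0..<int N}. exp (2 * complex_of_real pi * \<i> * of_int (a * k) / of_nat N))
       = (if int N dvd a then of_nat N else 0)"
proof -
  define w where "w = exp (2 * complex_of_real pi * \<i> * of_int a / of_nat N)"
  have w1: "w = 1 \<longleftrightarrow> int N dvd a"
  proof -
    have "w = 1 \<longleftrightarrow> (\<exists>n::int. 2 * pi * of_int a / real N = of_int (2 * n) * pi)"
      unfolding w_def exp_eq_1 by (simp add: Re_divide_of_nat Im_divide_of_nat)
    also have "\<dots> \<longleftrightarrow> (\<exists>n::int. real_of_int a = of_int (int N * n))"
      using assms by (intro ex_cong1) (auto simp: field_simps)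
    also have "\<dots> \<longleftrightarrow> int N dvd a"
      unfolding of_int_eq_iff dvd_def ..
    finally show ?thesis .
  qed
  have wN: "w ^ N = 1"
  proof -
    have "w ^ N = exp (of_nat N * (2 * complex_of_real pi * \<i> * of_int a / of_nat N))"
      unfolding w_def by (rule exp_of_nat_mult [symmetric])
    also have "of_nat N * (2 * complex_of_real pi * \<i> * of_int a / of_nat N) =
               (2 * of_int a * pi) * \<i>"
      using assms by simp
    also have "exp \<dots> = 1"
      by (rule exp_integer_2pi) simp
    finally show ?thesis .
  qed
  have img: "{0..<int N} = int ` {..<N}"
    using image_int_atLeastLessThan [of 0 N] by (simp add: lessThan_atLeast0)
  have "(\<Sum>k\<in>{0..<int N}. exp (2 * complex_of_real pi * \<i> * of_int (a * k) / of_nat N))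
        = (\<Sum>k<N. exp (2 * complex_of_real pi * \<i> * of_int (a * int k) / of_nat N))"
    unfolding img by (simp add: sum.reindex)
  also have "\<dots> = (\<Sum>k<N. w ^ k)"
    unfolding w_def by (intro sum.cong refl) (simp add: exp_of_nat_mult [symmetric] algebra_simps)
  also have "\<dots> = (if int N dvd a then of_nat N else 0)"
    using w1 wN by (auto simp: geometric_sum)
  finally show ?thesis .
qed

text \<open>A character of the product group is a product of one-dimensional characters, so the sum
  factors over the coordinates. A coordinate where \<open>x\<close> and \<open>y\<close> differ
  makes its factor zero.\<close>

lemma character_orthogonality:
  assumes "N > 0" and x: "x \<in> ZN_power d N" and y: "y \<in> ZN_power d N"
  shows "(\<Sum>m\<in>ZN_power d N.
            exp (2 * complex_of_real pi * \<i> * of_int (\<Sum>j=1..d. (x j - y j) * m j) / of_nat N))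
       = (if x = y then of_nat N ^ d else 0)"
proof -
  have "(\<Sum>m\<in>ZN_power d N.
            exp (2 * complex_of_real pi * \<i> * of_int (\<Sum>j=1..d. (x j - y j) * m j) / of_nat N))
      = (\<Sum>m\<in>ZN_power d N.
            \<Prod>j=1..d. exp (2 * complex_of_real pi * \<i> * of_int ((x j - y j) * m j) / of_nat N))"
    by (simp add: exp_sum [symmetric] sum_distrib_left sum_divide_distrib)
  also have "\<dots> = (\<Prod>j=1..d. \<Sum>k\<in>{0..<int N}.
                      exp (2 * complex_of_real pi * \<i> * of_int ((x j - y j) * k) / of_nat N))"
    unfolding ZN_power_eq_PiE [OF assms(1)] by (rule prod_sum_PiE [symmetric]) auto
  also have "\<dots> = (\<Prod>j=1..d. if int N dvd x j - y j then of_nat N else 0)"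
    by (intro prod.cong refl sum_exp_int_mod assms)
  also have "\<dots> = (if x = y then of_nat N ^ d else 0)"
  proof (cases "x = y")
    case True
    then show ?thesis by simp
  next
    case False
    then obtain j where j: "j \<in> {1..d}" "x j \<noteq> y j"
      using x y unfolding ZN_power_eq_PiE [OF assms(1)] by (metis PiE_ext)
    \<comment> \<open>Both coordinates are reduced representatives, so congruence modulo N would
      force equality.\<close>
    have "x j \<in> {0..<int N}" "y j \<in> {0..<int N}"
      using x y j(1) unfolding ZN_power_eq_PiE [OF assms(1)] by (blast dest: PiE_mem)+
    then have "\<not> int N dvd x j - y j"
      using j(2) by (auto simp: mod_eq_dvd_iff [symmetric])
    with j(1) False show ?thesis
      by (auto intro!: prod_zero)
  qed
  finally show ?thesis .
qed

section \<open>Fourier inversion and the uncertainty principle\<close>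

lemma powr_half_mult_self:
  assumes "N > 0"
  shows "real N powr (- (real d / 2)) * real N powr (- (real d / 2)) = inverse (real N ^ d)"
proof -
  have "real N powr (- (real d / 2)) * real N powr (- (real d / 2)) = real N powr (- real d)"
    by (simp only: powr_add [symmetric]) simp
  with assms show ?thesis by (simp add: powr_minus powr_realpow)
qed

text \<open>After the two sums are exchanged, orthogonality keeps only the term
  \<open>y = x\<close>, with weight \<open>N ^ d\<close>; the two normalizing factors
  \<open>N powr (- d / 2)\<close> cancel this weight.\<close>

lemma fourier_inversion:
  assumes "N > 0" and x: "x \<in> ZN_power d N"
  shows "f x = complex_of_real (real N powr (- (real d / 2))) *
           (\<Sum>m\<in>ZN_power d N. fourier d N f m *
              exp (2 * complex_of_real pi * \<i> * of_int (\<Sum>j=1..d. x j * m j) / of_nat N))"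
    (is "_ = ?c * ?R")
proof -
  let ?e = "\<lambda>t. exp (2 * complex_of_real pi * \<i> * of_int t / of_nat N)"
  have split: "exp (- (2 * complex_of_real pi * \<i> * of_int (\<Sum>j=1..d. y j * m j) / of_nat N)) *
      ?e (\<Sum>j=1..d. x j * m j) = ?e (\<Sum>j=1..d. (x j - y j) * m j)" for y m :: "nat \<Rightarrow> int"
    unfolding exp_add [symmetric]
    by (simp add: algebra_simps sum_subtractf diff_divide_distrib)
  have "?R = (\<Sum>m\<in>ZN_power d N. \<Sum>y\<in>ZN_power d N. ?c * f y * ?e (\<Sum>j=1..d. (x j - y j) * m j))"
    unfolding fourier_def sum_distrib_left sum_distrib_right split [symmetric]
    by (simp only: mult.assoc)
  also have "\<dots> = (\<Sum>y\<in>ZN_power d N. ?c * f y * (\<Sum>m\<in>ZN_power d N. ?e (\<Sum>j=1..d. (x j - y j) * m j)))"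
    unfolding sum_distrib_left by (rule sum.swap)
  also have "\<dots> = (\<Sum>y\<in>ZN_power d N. if x = y then ?c * f y * of_nat N ^ d else 0)"
    by (intro sum.cong refl) (subst character_orthogonality [OF assms(1) x], auto)
  also have "\<dots> = ?c * f x * of_nat N ^ d"
    using x finite_ZN_power [OF assms(1)] by simp
  finally have "?c * ?R = complex_of_real (real N powr (- (real d / 2)) * real N powr (- (real d / 2)))
                            * of_nat N ^ d * f x"
    by simp
  then show ?thesis
    unfolding powr_half_mult_self [OF assms(1)] using assms(1) by simp
qed

lemma norm_fourier_le:
  assumes "N > 0" and "\<And>x. x \<in> ZN_power d N \<Longrightarrow> norm (f x) \<le> M"
  shows "norm (fourier d N f m) \<le>
           real N powr (- (real d / 2)) * (real (card {x \<in> ZN_power d N. f x \<noteq> 0}) * M)"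
proof -
  let ?A = "{x \<in> ZN_power d N. f x \<noteq> 0}"
  let ?t = "\<lambda>x. f x * exp (- (2 * complex_of_real pi * \<i> * of_int (\<Sum>j=1..d. x j * m j) / of_nat N))"
  have unit: "norm (?t x) = norm (f x)" for x
    by (simp add: norm_mult Re_divide_of_nat)
  have "(\<Sum>x\<in>ZN_power d N. ?t x) = (\<Sum>x\<in>?A. ?t x)"
    using finite_ZN_power [OF assms(1)] by (intro sum.mono_neutral_right) auto
  also have "norm \<dots> \<le> real (card ?A) * M"
    using assms(2) by (intro sum_norm_bound) (auto simp only: unit)
  finally show ?thesis
    by (simp add: fourier_def norm_mult mult_left_mono)
qed

text \<open>Evaluate the inversion formula at a point where the modulus of \<open>f\<close> attains
  its maximum M. Only frequencies in \<open>S\<close> contribute, and \<open>norm_fourier_le\<close>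
  bounds each coefficient by the support size times M, up to normalization. Hence M \<le> N^(-d) |S|
  |supp f| M, and M > 0 cancels.\<close>

lemma uncertainty_principle:
  assumes "N > 0" and fin: "finite S"
    and spec: "\<And>m. m \<in> ZN_power d N - S \<Longrightarrow> fourier d N f m = 0"
    and nz: "z \<in> ZN_power d N" "f z \<noteq> 0"
  shows "real N ^ d \<le> real (card S) * real (card {x \<in> ZN_power d N. f x \<noteq> 0})"
proof -
  let ?Z = "ZN_power d N" and ?A = "{x \<in> ZN_power d N. f x \<noteq> 0}"
  let ?c = "real N powr (- (real d / 2))"
  have finZ: "finite ?Z" by (rule finite_ZN_power [OF assms(1)])
  define M where "M = Max ((\<lambda>x. norm (f x)) ` ?Z)"
  have le_M: "norm (f x) \<le> M" if "x \<in> ?Z" for x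
    unfolding M_def using finZ that by (intro Max_ge) auto
  have "M \<in> (\<lambda>x. norm (f x)) ` ?Z"
    unfolding M_def using finZ nz(1) by (intro Max_in) auto
  then obtain x where x: "x \<in> ?Z" "norm (f x) = M" by auto
  have "M > 0" using le_M [OF nz(1)] nz(2) by (smt (verit) zero_less_norm_iff)
  let ?t = "\<lambda>m. fourier d N f m *
      exp (2 * complex_of_real pi * \<i> * of_int (\<Sum>j=1..d. x j * m j) / of_nat N)"
  have unit: "norm (?t m) = norm (fourier d N f m)" for m
    by (simp add: norm_mult Re_divide_of_nat)
  have "(\<Sum>m\<in>?Z. ?t m) = (\<Sum>m\<in>?Z \<inter> S. ?t m)"
    using finZ spec by (intro sum.mono_neutral_right) auto
  also have "norm \<dots> \<le> real (card (?Z \<inter> S)) * (?c * (real (card ?A) * M))"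
    using norm_fourier_le [OF assms(1)] le_M by (intro sum_norm_bound) (auto simp only: unit)
  also have "\<dots> \<le> real (card S) * (?c * (real (card ?A) * M))"
    using \<open>M > 0\<close> fin by (intro mult_right_mono) (auto intro: card_mono)
  finally have "?c * norm (\<Sum>m\<in>?Z. ?t m) \<le> ?c * (real (card S) * (?c * (real (card ?A) * M)))"
    by (intro mult_left_mono) auto
  moreover have "M = ?c * norm (\<Sum>m\<in>?Z. ?t m)"
    unfolding x(2) [symmetric] by (subst fourier_inversion [OF assms(1) x(1)]) (simp add: norm_mult)
  ultimately have "M \<le> (?c * ?c) * (real (card S) * real (card ?A)) * M"
    by (simp add: mult_ac)
  then have "1 \<le> inverse (real N ^ d) * (real (card S) * real (card ?A))"
    unfolding powr_half_mult_self [OF assms(1)] using \<open>M > 0\<close> by simp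
  then show ?thesis
    using assms(1) by (simp add: field_simps)
qed

section \<open>Estimates for p-norms\<close>

lemma powr_midpoint_le:
  fixes a b p :: real
  assumes "a \<ge> 0" "b \<ge> 0" "p \<ge> 1"
  shows "((a + b) / 2) powr p \<le> (a powr p + b powr p) / 2"
proof -
  have half: "(c / 2) powr p \<le> c powr p / 2" if "c \<ge> 0" for c
  proof -
    have "(2::real) powr 1 \<le> 2 powr p" using assms(3) by (intro powr_mono) auto
    then have "c powr p / 2 powr p \<le> c powr p / 2"
      by (intro divide_left_mono) auto
    then show ?thesis using that by (simp add: powr_divide)
  qed
  show ?thesis
  \<comment> \<open>Convexity is derived from the second derivative on the open half-line, so
    arguments equal to 0 are treated separately through \<open>half\<close>.\<close>
  proof (cases "a = 0 \<or> b = 0")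
    case True
    then show ?thesis using half assms by auto
  next
    case False
    have "convex_on {0<..} (\<lambda>x::real. x powr p)"
    proof (rule f''_ge0_imp_convex)
      show "((\<lambda>x. x powr p) has_real_derivative p * x powr (p - 1)) (at x)" if "x \<in> {0<..}" for x :: real
        using that by (auto intro!: derivative_eq_intros)
      show "((\<lambda>x. p * x powr (p - 1)) has_real_derivative p * ((p - 1) * x powr (p - 1 - 1))) (at x)"
        if "x \<in> {0<..}" for x :: real
        using that by (auto intro!: derivative_eq_intros)
    qed (use assms in auto)
    from convex_onD [OF this, of "1/2" a b] False assms show ?thesis
      by (simp add: field_simps)
  qed
qed

text \<open>Writing |g| + |f| as twice its midpoint makes convexity yield the constant
  \<open>2 powr p / 2\<close>. When both sums are equal this is exactly \<open>2 powr p\<close>, so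
  no loss occurs in \<open>Lp_norm_diff_le\<close>.\<close>

lemma sum_powr_diff_le:
  fixes f g :: "'a \<Rightarrow> real"
  assumes "p \<ge> 1"
  shows "(\<Sum>x\<in>A. \<bar>g x - f x\<bar> powr p) \<le>
         2 powr p * ((\<Sum>x\<in>A. \<bar>g x\<bar> powr p) + (\<Sum>x\<in>A. \<bar>f x\<bar> powr p)) / 2"
proof -
  have "\<bar>g x - f x\<bar> powr p \<le> 2 powr p * (\<bar>g x\<bar> powr p + \<bar>f x\<bar> powr p) / 2" for x
  proof -
    have "\<bar>g x - f x\<bar> powr p \<le> (2 * ((\<bar>g x\<bar> + \<bar>f x\<bar>) / 2)) powr p"
      using assms abs_triangle_ineq4 [of "g x" "f x"] by (intro powr_mono2) simp_all
    also have "\<dots> = 2 powr p * ((\<bar>g x\<bar> + \<bar>f x\<bar>) / 2) powr p"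
      by (rule powr_mult)
    also have "\<dots> \<le> 2 powr p * ((\<bar>g x\<bar> powr p + \<bar>f x\<bar> powr p) / 2)"
      using assms by (intro mult_left_mono powr_midpoint_le) auto
    finally show ?thesis by simp
  qed
  then have "(\<Sum>x\<in>A. \<bar>g x - f x\<bar> powr p) \<le>
             (\<Sum>x\<in>A. 2 powr p * (\<bar>g x\<bar> powr p + \<bar>f x\<bar> powr p) / 2)"
    by (intro sum_mono)
  also have "\<dots> = 2 powr p * ((\<Sum>x\<in>A. \<bar>g x\<bar> powr p) + (\<Sum>x\<in>A. \<bar>f x\<bar> powr p)) / 2"
    by (simp only: sum.distrib [symmetric] sum_distrib_left sum_divide_distrib)
  finally show ?thesis .
qed

lemma Lp_norm_powr:
  assumes "p > 0"
  shows "Lp_norm d N p f powr p = (\<Sum>x\<in>ZN_power d N. norm (f x) powr p)"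
  using assms by (simp add: Lp_norm_def powr_powr sum_nonneg)

text \<open>The case of the triangle inequality needed for comparing a competitor \<open>g\<close>
  with \<open>f\<close>; it follows from the convexity bound on p-th powers.\<close>

lemma Lp_norm_diff_le:
  fixes f g :: "(nat \<Rightarrow> int) \<Rightarrow> real"
  assumes "p \<ge> 1" and le: "Lp_norm d N p g \<le> Lp_norm d N p f"
  shows "Lp_norm d N p (\<lambda>x. g x - f x) \<le> 2 * Lp_norm d N p f"
proof -
  have nn: "Lp_norm d N p h \<ge> 0" for h :: "(nat \<Rightarrow> int) \<Rightarrow> real" by (simp add: Lp_norm_def)
  have "Lp_norm d N p g powr p \<le> Lp_norm d N p f powr p"
    using assms nn by (intro powr_mono2) auto
  then have "2 powr p * (Lp_norm d N p g powr p + Lp_norm d N p f powr p) / 2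
             \<le> 2 powr p * (Lp_norm d N p f powr p + Lp_norm d N p f powr p) / 2"
    by (intro divide_right_mono mult_left_mono add_right_mono) auto
  moreover have "Lp_norm d N p (\<lambda>x. g x - f x) powr p
                 \<le> 2 powr p * (Lp_norm d N p g powr p + Lp_norm d N p f powr p) / 2"
    using sum_powr_diff_le [OF assms(1), of g f "ZN_power d N"] assms(1)
    by (simp add: Lp_norm_powr)
  ultimately have "Lp_norm d N p (\<lambda>x. g x - f x) powr p \<le>
      2 powr p * (Lp_norm d N p f powr p + Lp_norm d N p f powr p) / 2"
    by (rule order_trans [rotated])
  then have "Lp_norm d N p (\<lambda>x. g x - f x) powr p \<le> 2 powr p * Lp_norm d N p f powr p"
    by simp
  also have "\<dots> = (2 * Lp_norm d N p f) powr p"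
    by (rule powr_mult [symmetric])
  \<comment> \<open>The negated strict form is the one that contradicts strict monotonicity of the
    p-th power, which removes the exponent.\<close>
  finally have "\<not> (2 * Lp_norm d N p f) powr p < Lp_norm d N p (\<lambda>x. g x - f x) powr p"
    by simp
  then show ?thesis
    using assms(1) nn [of f] powr_less_mono2 [of p "2 * Lp_norm d N p f" "Lp_norm d N p (\<lambda>x. g x - f x)"]
    by force
qed

text \<open>Each support point contributes at least \<open>\<delta> powr p\<close> to the sum of
  p-th powers.\<close>

lemma Lp_norm_ge_support:
  fixes h :: "(nat \<Rightarrow> int) \<Rightarrow> real"
  assumes "N > 0" "p > 0" "\<delta> > 0"
    and "\<And>x. x \<in> ZN_power d N \<Longrightarrow> h x \<noteq> 0 \<Longrightarrow> \<delta> \<le> \<bar>h x\<bar>"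
  shows "\<delta> * real (card {x \<in> ZN_power d N. h x \<noteq> 0}) powr (1 / p) \<le> Lp_norm d N p h"
proof -
  let ?A = "{x \<in> ZN_power d N. h x \<noteq> 0}"
  have "\<delta> * real (card ?A) powr (1 / p) = (\<delta> powr p * real (card ?A)) powr (1 / p)"
    using assms by (simp add: powr_mult powr_powr)
  also have "\<dots> \<le> (\<Sum>x\<in>ZN_power d N. norm (h x) powr p) powr (1 / p)"
  proof (intro powr_mono2)
    have "real (card ?A) * \<delta> powr p \<le> (\<Sum>x\<in>?A. norm (h x) powr p)"
      using assms by (intro sum_bounded_below) (auto intro!: powr_mono2)
    also have "\<dots> \<le> (\<Sum>x\<in>ZN_power d N. norm (h x) powr p)"
      using finite_ZN_power [OF assms(1)] by (intro sum_mono2) auto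
    finally show "\<delta> powr p * real (card ?A) \<le> (\<Sum>x\<in>ZN_power d N. norm (h x) powr p)"
      by (simp add: mult.commute)
  qed (use assms in auto)
  finally show ?thesis by (simp add: Lp_norm_def)
qed

section \<open>Quantization gap and uniqueness of the minimizer\<close>

lemma quantized_signals_diff_ge:
  assumes "u \<in> quantized_signals \<delta> d N" "v \<in> quantized_signals \<delta> d N" "\<delta> > 0"
    and "x \<in> ZN_power d N" "u x \<noteq> v x"
  shows "\<delta> \<le> \<bar>u x - v x\<bar>"
proof -
  obtain k l :: int where kl: "u x = \<delta> * of_int k" "v x = \<delta> * of_int l"
    using PiE_mem [OF assms(1) [unfolded quantized_signals_def] assms(4)]
      PiE_mem [OF assms(2) [unfolded quantized_signals_def] assms(4)] by auto
  with assms(5) have "1 \<le> \<bar>k - l\<bar>" by auto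
  then have "1 \<le> \<bar>real_of_int (k - l)\<bar>" by linarith
  with assms(3) have "\<delta> * 1 \<le> \<delta> * \<bar>real_of_int (k - l)\<bar>" by (intro mult_left_mono) auto
  also have "\<dots> = \<bar>u x - v x\<bar>"
    using assms(3) by (simp add: kl abs_mult right_diff_distrib [symmetric])
  finally show ?thesis by simp
qed

lemma fourier_diff: "fourier d N (\<lambda>x. f x - g x) m = fourier d N f m - fourier d N g m"
  by (simp add: fourier_def left_diff_distrib sum_subtractf right_diff_distrib)

text \<open>The non-asymptotic core, for one fixed N: a nonzero difference \<open>u - f\<close>
  would have p-norm too large for two signals of small norm.\<close>

lemma feasible_Lp_norm_le_unique:
  assumes N: "N > 0" and p: "2 \<le> p" and "\<delta> > 0" and "C > 0"
    and f: "f \<in> quantized_signals \<delta> d N"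
    and S: "S \<subseteq> ZN_power d N" "real (card S) \<le> C * real N powr \<alpha>"
    and small: "Lp_norm d N p f < \<delta> / (2 * sqrt C) * real N powr (real d / p - \<alpha> / 2)"
    and u: "feasible \<delta> d N S f u" "Lp_norm d N p u \<le> Lp_norm d N p f"
  shows "u = f"
proof (rule ccontr)
  assume "u \<noteq> f"
  have uq: "u \<in> quantized_signals \<delta> d N" using u(1) by (simp add: feasible_def)
  \<comment> \<open>Signals are extensional, so two different ones already differ at a point of the
    group.\<close>
  obtain z where z: "z \<in> ZN_power d N" "u z \<noteq> f z"
    using PiE_ext [of u "ZN_power d N" _ f] uq f \<open>u \<noteq> f\<close> unfolding quantized_signals_def by blast
  let ?A = "{x \<in> ZN_power d N. u x - f x \<noteq> 0}"
  have finS: "finite S" using S(1) finite_ZN_power [OF N] by (rule finite_subset)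
  have "real N ^ d \<le> real (card S) *
          real (card {x \<in> ZN_power d N. complex_of_real (u x) - complex_of_real (f x) \<noteq> 0})"
    using N finS z u(1) by (intro uncertainty_principle) (auto simp: fourier_diff feasible_def)
  then have unc: "real N ^ d \<le> real (card S) * real (card ?A)" by simp
  define T where "T = C * real N powr \<alpha>"
  have "real N ^ d > 0" using N by simp
  \<comment> \<open>A nonempty \<open>S\<close> has cardinality at least 1, hence T \<ge> 1. This is
    what permits replacing the exponent 1/2 by the smaller 1/p below.\<close>
  with unc have "card S \<noteq> 0" by (intro notI) simp
  then have T1: "1 \<le> T" using S(2) unfolding T_def by linarith
  have "real N ^ d \<le> T * real (card ?A)"
    unfolding T_def by (rule order_trans [OF unc mult_right_mono [OF S(2)]]) simp
  then have "real N ^ d / T \<le> real (card ?A)"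
    using T1 by (simp add: field_simps)
  then have card_ge: "(real N ^ d / T) powr (1 / p) \<le> real (card ?A) powr (1 / p)"
    using p T1 by (intro powr_mono2) auto
  \<comment> \<open>The chain starts from twice the threshold in \<open>small\<close> and ends
    strictly below it, the factor 2 coming from \<open>Lp_norm_diff_le\<close>.\<close>
  have "\<delta> / sqrt C * real N powr (real d / p - \<alpha> / 2) = \<delta> * (real N powr (d / p) / T powr (1 / 2))"
  proof -
    have "T powr (1 / 2) = sqrt C * real N powr (\<alpha> / 2)"
      using \<open>C > 0\<close> by (simp add: T_def powr_mult powr_powr powr_half_sqrt)
    then show ?thesis by (simp add: powr_diff)
  qed
  also have "\<dots> \<le> \<delta> * (real N powr (d / p) / T powr (1 / p))"
  proof -
    have "T powr (1 / p) \<le> T powr (1 / 2)"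
      using p T1 by (intro powr_mono) (simp_all add: field_simps)
    then show ?thesis
      using T1 \<open>\<delta> > 0\<close> by (intro mult_left_mono divide_left_mono) simp_all
  qed
  also have "\<dots> = \<delta> * (real N ^ d / T) powr (1 / p)"
  proof -
    have "(real N ^ d) powr (1 / p) = real N powr (d / p)"
      using N powr_powr [of "real N" "real d" "1 / p"] by (simp add: powr_realpow)
    then show ?thesis by (simp add: powr_divide)
  qed
  also have "\<dots> \<le> \<delta> * real (card ?A) powr (1 / p)"
    using card_ge \<open>\<delta> > 0\<close> by simp
  also have "\<dots> \<le> Lp_norm d N p (\<lambda>x. u x - f x)"
    using N p \<open>\<delta> > 0\<close> quantized_signals_diff_ge [OF uq f]
    by (intro Lp_norm_ge_support) auto
  also have "\<dots> \<le> 2 * Lp_norm d N p f"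
    using p u(2) by (intro Lp_norm_diff_le) auto
  also have "\<dots> < \<delta> / sqrt C * real N powr (real d / p - \<alpha> / 2)"
    using small by simp
  finally show False by simp
qed

theorem theorem12:
  fixes d :: nat and \<alpha> p \<delta> C_size :: real
    and f :: "nat \<Rightarrow> (nat \<Rightarrow> int) \<Rightarrow> real"
    and S :: "nat \<Rightarrow> (nat \<Rightarrow> int) set"
  assumes "d \<ge> 1"
    and "0 < \<alpha>" and "\<alpha> < real d"
    and "2 \<le> p" and "p < 2 * real d / \<alpha>"
    and "\<delta> > 0"
    and "\<And>N. N \<ge> 1 \<Longrightarrow> f N \<in> quantized_signals \<delta> d N"
    and "\<And>N. N \<ge> 1 \<Longrightarrow> S N \<subseteq> ZN_power d N"
    and "C_size > 0"
    and "\<And>N. N \<ge> 1 \<Longrightarrow> real (card (S N)) \<le> C_size * real N powr \<alpha>"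
    and "\<forall>\<^sub>F N in sequentially.
           Lp_norm d N p (f N) < \<delta> / (2 * sqrt C_size) * real N powr (real d / p - \<alpha> / 2)"
  shows "\<forall>\<^sub>F N in sequentially.
           {u. is_arg_min (Lp_norm d N p) (feasible \<delta> d N (S N) (f N)) u} = {f N}"
  using assms(11) eventually_ge_at_top [of 1]
proof eventually_elim
  case (elim N)
  have f_feasible: "feasible \<delta> d N (S N) (f N) (f N)"
    using assms(7) elim by (simp add: feasible_def)
  have "u = f N" if "feasible \<delta> d N (S N) (f N) u" "Lp_norm d N p u \<le> Lp_norm d N p (f N)" for u
    using assms elim that
    by (intro feasible_Lp_norm_le_unique [of N p \<delta> C_size "f N" d "S N" \<alpha> u]) auto
  \<comment> \<open>A feasible \<open>u\<close> either has norm at most that of \<open>f N\<close>,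
    and then equals it, or has strictly larger norm. So \<open>f N\<close> is a minimizer, and any
    other minimizer falls under the first case.\<close>
  moreover from this have "Lp_norm d N p (f N) \<le> Lp_norm d N p u"
    if "feasible \<delta> d N (S N) (f N) u" for u
    using that by (cases "Lp_norm d N p u \<le> Lp_norm d N p (f N)") auto
  ultimately show ?case using f_feasible
    unfolding is_arg_min_linorder set_eq_iff mem_Collect_eq singleton_iff by blast
qed

end
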